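(* Let $\mathcal H^0_{\mathbb Z}\subseteq\mathcal H_{\mathbb Z}$ be the $\mathbb Q$-linear span of $\mathbf 1$ together with all $[s_1,\dots,s_k]$ ($k\ge1$, $s_i\in\mathbb Z$) satisfying $s_1+\cdots+s_j>j$ for every $j=1,\dots,k$. Then $\mathcal H^0_{\mathbb Z}$ is closed under the extended shuffle product $\sqcup\!\sqcup$, so that $(\mathcal H^0_{\mathbb Z},\sqcup\!\sqcup)$ is a subalgebra of $(\mathcal H_{\mathbb Z},\sqcup\!\sqcup)$.
   Context: Let $\mathcal H_{\mathbb Z}$ be the $\mathbb Q$-vector space with basis $\mathbf 1$ together with the formal symbols $[s_1,\dots,s_k]$ for $k\ge1$ and $(s_1,\dots,s_k)\in\mathbb Z^k$. The depth of $[s_1,\dots,s_k]$ is $k$, and the depth of $\mathbf 1$ is $0$. Define linear maps on basis elements of positive depth by $I([s_1,s_2,\dots,s_k])=[s_1+1,s_2,\dots,s_k]$ and $J([s_1,s_2,\dots,s_k])=[s_1-1,s_2,\dots,s_k]$, and set $J(\mathbf 1)=0$. Notation: for a basis element $[s_1,\dots,s_k]$ of positive depth, $[\vec s\,']$ denotes $[s_2,\dots,s_k]$, or $\mathbf 1$ if $k=1$, and we write $[s_1,\dots,s_k]=[s_1,\vec s\,']$. For $a\in\mathbb Z$ and $X=\sum c_{\vec v}[\vec v]$ (where $\mathbf 1$ may occur), put $[a,X]:=\sum c_{\vec v}[a,\vec v]$, with the convention $[a,\mathbf 1]:=[a]$. The extended shuffle product $\sqcup\!\sqcup$ is the bilinear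 product on $\mathcal H_{\mathbb Z}$ with two-sided unit $\mathbf 1$, defined on basis elements $[s_1,\vec s\,']$, $[t_1,\vec t\,']$ of positive depth by the following recursions: <ul> <li>(i) if $s_1=0$: $[0,\vec s\,']\sqcup\!\sqcup[t_1,\vec t\,']=[0,[\vec s\,']\sqcup\!\sqcup[t_1,\vec t\,']]$;</li> <li>(ii) if $s_1>0$ and $t_1=0$: $[s_1,\vec s\,']\sqcup\!\sqcup[0,\vec t\,']=[0,[s_1,\vec s\,']\sqcup\!\sqcup[\vec t\,']]$;</li> <li>(iii) if $s_1>0$ and $t_1>0$: $[s_1,\vec s\,']\sqcup\!\sqcup[t_1,\vec t\,']=I([s_1,\vec s\,']\sqcup\!\sqcup[t_1-1,\vec t\,'])+I([s_1-1,\vec s\,']\sqcup\!\sqcup[t_1,\vec t\,'])$;</li> <li>(iv) if $s_1>0$ and $t_1<0$: $[s_1,\vec s\,']\sqcup\!\sqcup[t_1,\vec t\,']=J([s_1,\vec s\,']\sqcup\!\sqcup[t_1+1,\vec t\,'])-[s_1-1,\vec s\,']\sqcup\!\sqcup[t_1+1,\vec t\,']$;</li> <li>(v) if $s_1<0$: $[s_1,\vec s\,']\sqcup\!\sqcup[t_1,\vec t\,']=J([s_1+1,\vec s\,']\sqcup\!\sqcup[t_1,\vec t\,'])-[s_1+1,\vec s\,']\sqcup\!\sqcup[t_1-1,\vec t\,']$.</li> </ul> The recursions are well founded: (i) and (ii) proceed by induction on total depth, (iii) by induction on $s_1+t_1$, (iv) on $|t_1|$, and (v) on $|s_1|$. 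*)

theory Defs
  imports Complex_Main "HOL-Library.Poly_Mapping"
begin

text \<open>
  The space \<open>\<H>\<^sub>\<int>\<close> is the free \<open>\<rat>\<close>-vector space on finite lists of integers;
  the empty list stands for the basis element \<open>\<one>\<close>, and the depth of a basis element is the
  length of the list.
\<close>

type_synonym hz = "int list \<Rightarrow>\<^sub>0 rat"

abbreviation hbasis :: "int list \<Rightarrow> hz" where
  "hbasis s \<equiv> Poly_Mapping.single s 1"

abbreviation hone :: hz where
  "hone \<equiv> hbasis []"

definition hscale :: "rat \<Rightarrow> hz \<Rightarrow> hz" where
  "hscale c X = Poly_Mapping.map (\<lambda>x. c * x) X"

lemma lookup_hscale [simp]: "Poly_Mapping.lookup (hscale c X) v = c * Poly_Mapping.lookup X v"
  by (simp add: hscale_def Poly_Mapping.map.rep_eq when_def)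

global_interpretation hz: vector_space hscale
  by unfold_locales (auto intro!: poly_mapping_eqI simp: lookup_add algebra_simps)

definition hlin :: "(int list \<Rightarrow> hz) \<Rightarrow> hz \<Rightarrow> hz" where
  "hlin f X = (\<Sum>v\<in>Poly_Mapping.keys X. hscale (Poly_Mapping.lookup X v) (f v))"

text \<open>
  The operator \<open>I\<close> is only meaningful on the span of the basis elements of positive depth; the
  value \<open>0\<close> at \<open>\<one>\<close> is a dummy, as the product of two basis elements of positive depth
  never involves \<open>\<one>\<close>.  For \<open>J\<close>, the value \<open>0\<close> at \<open>\<one>\<close> is part of the definition.
\<close>

definition hI :: "hz \<Rightarrow> hz" where
  "hI = hlin (\<lambda>v. case v of [] \<Rightarrow> 0 | s # ss \<Rightarrow> hbasis ((s + 1) # ss))"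

definition hJ :: "hz \<Rightarrow> hz" where
  "hJ = hlin (\<lambda>v. case v of [] \<Rightarrow> 0 | s # ss \<Rightarrow> hbasis ((s - 1) # ss))"

definition hcons :: "int \<Rightarrow> hz \<Rightarrow> hz" where
  "hcons a = hlin (\<lambda>v. hbasis (a # v))"

function shuffle_basis :: "int list \<Rightarrow> int list \<Rightarrow> hz" where
  "shuffle_basis [] t = hbasis t"
| "shuffle_basis (s1 # s) [] = hbasis (s1 # s)"
| "shuffle_basis (s1 # s) (t1 # t) =
    (if s1 = 0 then hcons 0 (shuffle_basis s (t1 # t))
     else if s1 > 0 \<and> t1 = 0 then hcons 0 (shuffle_basis (s1 # s) t)
     else if s1 > 0 \<and> t1 > 0 then
       hI (shuffle_basis (s1 # s) ((t1 - 1) # t)) + hI (shuffle_basis ((s1 - 1) # s) (t1 # t))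
     else if s1 > 0 \<and> t1 < 0 then
       hJ (shuffle_basis (s1 # s) ((t1 + 1) # t)) - shuffle_basis ((s1 - 1) # s) ((t1 + 1) # t)
     else
       hJ (shuffle_basis ((s1 + 1) # s) (t1 # t)) - shuffle_basis ((s1 + 1) # s) ((t1 - 1) # t))"
  by pat_completeness auto
termination
  by (relation "measures
       [\<lambda>(s, t). length s + length t,
        \<lambda>(s, t). if s = [] then 0 else nat (- hd s),
        \<lambda>(s, t). if t = [] then 0 else nat (- hd t),
        \<lambda>(s, t). if s = [] \<or> t = [] then 0 else nat (hd s + hd t)]") auto

definition shuffle :: "hz \<Rightarrow> hz \<Rightarrow> hz" where
  "shuffle X Y = hlin (\<lambda>s. hlin (\<lambda>t. shuffle_basis s t) Y) X"

lemma hlin_superset: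
  assumes "finite A" "Poly_Mapping.keys X \<subseteq> A"
  shows "hlin f X = (\<Sum>v\<in>A. hscale (Poly_Mapping.lookup X v) (f v))"
  unfolding hlin_def using assms
  by (intro sum.mono_neutral_left) (auto simp: in_keys_iff)

lemma hlin_add: "hlin f (X + Y) = hlin f X + hlin f Y"
proof -
  let ?A = "Poly_Mapping.keys X \<union> Poly_Mapping.keys Y"
  have "Poly_Mapping.keys (X + Y) \<subseteq> ?A"
    by (rule keys_add)
  then show ?thesis
    by (simp add: hlin_superset[of ?A] lookup_add hz.scale_left_distrib sum.distrib)
qed

lemma hlin_scale: "hlin f (hscale c X) = hscale c (hlin f X)"
proof -
  have "Poly_Mapping.keys (hscale c X) \<subseteq> Poly_Mapping.keys X"
    by (auto simp: in_keys_iff)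
  then show ?thesis
    by (simp add: hlin_superset[of "Poly_Mapping.keys X"] hz.scale_sum_right)
qed

lemma hlin_basis [simp]: "hlin f (hbasis v) = f v"
  by (simp add: hlin_def)

lemma linear_hlin: "Vector_Spaces.linear hscale hscale (hlin f)"
  by unfold_locales (simp_all add: hlin_add hlin_scale)

lemma shuffle_basis_basis [simp]: "shuffle (hbasis s) (hbasis t) = shuffle_basis s t"
  by (simp add: shuffle_def)

lemma shuffle_linear_left: "Vector_Spaces.linear hscale hscale (\<lambda>X. shuffle X Y)"
  unfolding shuffle_def by (rule linear_hlin)

lemma shuffle_linear_right: "Vector_Spaces.linear hscale hscale (shuffle X)"
  by unfold_locales
     (simp_all add: shuffle_def hlin_def[of _ X] hlin_add hlin_scale hz.scale_right_distrib
        sum.distrib hz.scale_sum_right mult.commute)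

lemma hlin_hbasis_id: "hlin hbasis X = X"
proof (rule poly_mapping_eqI)
  fix w
  have "Poly_Mapping.lookup (hlin hbasis X) w =
      (\<Sum>v\<in>Poly_Mapping.keys X. if v = w then Poly_Mapping.lookup X v else 0)"
    unfolding hlin_def Poly_Mapping.lookup_sum
    by (intro sum.cong) (auto simp: lookup_single when_def)
  also have "\<dots> = Poly_Mapping.lookup X w"
    by (simp add: sum.delta in_keys_iff)
  finally show "Poly_Mapping.lookup (hlin hbasis X) w = Poly_Mapping.lookup X w" .
qed

lemma shuffle_one_left: "shuffle hone Y = Y"
proof -
  have "shuffle_basis [] = hbasis"
    by (rule ext) simp
  then show ?thesis
    by (simp add: shuffle_def hlin_hbasis_id)
qed

lemma shuffle_one_right: "shuffle X hone = X"
proof -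
  have "(\<lambda>s. shuffle_basis s []) = hbasis"
  proof
    show "shuffle_basis s [] = hbasis s" for s
      by (cases s) simp_all
  qed
  then show ?thesis
    by (simp add: shuffle_def hlin_hbasis_id)
qed

lemma lookup_hlin_Nil:
  assumes "\<And>v. Poly_Mapping.lookup (f v) [] = 0"
  shows "Poly_Mapping.lookup (hlin f X) [] = 0"
  using assms by (simp add: hlin_def Poly_Mapping.lookup_sum)

lemma shuffle_basis_positive_depth:
  "[] \<notin> Poly_Mapping.keys (shuffle_basis (s1 # s) (t1 # t))"
proof -
  have I: "Poly_Mapping.lookup (hI X) [] = 0"
    and J: "Poly_Mapping.lookup (hJ X) [] = 0"
    and C: "Poly_Mapping.lookup (hcons a X) [] = 0" for X a
    unfolding hI_def hJ_def hcons_def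
    by (rule lookup_hlin_Nil; simp add: lookup_single split: list.split)+
  have "u \<noteq> [] \<Longrightarrow> v \<noteq> [] \<Longrightarrow> Poly_Mapping.lookup (shuffle_basis u v) [] = 0" for u v
  proof (induction u v rule: shuffle_basis.induct)
    case (3 s1 s t1 t)
    then show ?case
      by (auto simp: I J C lookup_add lookup_minus simp del: shuffle_basis.simps(3)
          simp: shuffle_basis.simps(3)[of s1 s t1 t])
  qed simp_all
  then show ?thesis
    by (simp add: in_keys_iff del: shuffle_basis.simps)
qed

definition admissible :: "int list \<Rightarrow> bool" where
  "admissible s \<longleftrightarrow> s \<noteq> [] \<and> (\<forall>j\<in>{1..length s}. (\<Sum>i<j. s ! i) > int j)"

definition hz0 :: "hz set" where
  "hz0 = hz.span (insert hone (hbasis ` {s. admissible s}))"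

end

theory Submission
  imports Defs
begin

text \<open>
  Let \<open>E(s)\<close> be the minimum of \<open>s\<^sub>1 + \<dots> + s\<^sub>j - j\<close> over \<open>1 \<le> j \<le> k\<close>, so that \<open>s\<close> is admissible iff
  \<open>E(s) \<ge> 1\<close>.  Every basis element \<open>v\<close> occurring in the product of \<open>s\<close> and \<open>t\<close> satisfies
  \<open>E(v) \<ge> min {E(s), E(t), E(s) + E(t)}\<close>, and this bound, unlike admissibility itself, is preserved by
  each of the five recursions: \<open>I\<close> and \<open>J\<close> shift \<open>E\<close> by one, and a nonpositive first entry
  \<open>s\<^sub>1 \<le> 0\<close> forces \<open>E(s) \<le> s\<^sub>1 - 1 < 0\<close>, which absorbs the terms that are off by one.
\<close>

text \<open>This is the condition \<open>E(v) >= n\<close>, peeled off from the front as in the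
  recursions of the product. The empty list meets every bound, as if \<open>E\<close> were infinite
  there.\<close>

fun excess_ge :: "int \<Rightarrow> int list \<Rightarrow> bool" where
  "excess_ge n [] \<longleftrightarrow> True"
| "excess_ge n (a # v) \<longleftrightarrow> n \<le> a - 1 \<and> excess_ge (n - (a - 1)) v"

lemma excess_ge_shift: "excess_ge (n - 1) ((a - 1) # v) \<longleftrightarrow> excess_ge n (a # v)"
  by (simp add: algebra_simps)

lemma excess_ge_mono: "excess_ge n v \<Longrightarrow> m \<le> n \<Longrightarrow> excess_ge m v"
  by (induction v arbitrary: m n) force+

lemma excess_ge_iff:
  "excess_ge n v \<longleftrightarrow> (\<forall>j\<in>{1..length v}. n + int j \<le> (\<Sum>i<j. v ! i))"
proof (induction v arbitrary: n)
  case (Cons a v)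
  \<comment> \<open>The prefix of length one is split off; each longer prefix is \<open>a\<close>
    followed by a nonempty prefix of \<open>v\<close>.\<close>
  have "{1..length (a # v)} = insert 1 (Suc ` {1..length v})"
    by (auto simp: image_Suc_atLeastAtMost)
  then have "(\<forall>j\<in>{1..length (a # v)}. n + int j \<le> (\<Sum>i<j. (a # v) ! i)) \<longleftrightarrow>
      n \<le> a - 1 \<and> (\<forall>j\<in>{1..length v}. n + int (Suc j) \<le> (\<Sum>i<Suc j. (a # v) ! i))"
    by (simp only: ball_simps) (simp add: algebra_simps)
  also have "\<dots> \<longleftrightarrow> excess_ge n (a # v)"
    unfolding sum.lessThan_Suc_shift by (auto simp: Cons.IH algebra_simps)
  finally show ?case ..
qed simp

lemma admissible_iff_excess_ge: "admissible v \<longleftrightarrow> v \<noteq> [] \<and> excess_ge 1 v"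
  by (auto simp: admissible_def excess_ge_iff)

definition excess_filtration :: "int \<Rightarrow> hz set" where
  "excess_filtration n = {X. \<forall>v\<in>Poly_Mapping.keys X. excess_ge n v}"

lemma excess_filtration_iff:
  "X \<in> excess_filtration n \<longleftrightarrow> (\<forall>v. Poly_Mapping.lookup X v \<noteq> 0 \<longrightarrow> excess_ge n v)"
  by (auto simp: excess_filtration_def in_keys_iff)

lemma subspace_excess_filtration: "hz.subspace (excess_filtration n)"
proof (rule hz.subspaceI)
  fix X Y assume "X \<in> excess_filtration n" "Y \<in> excess_filtration n"
  then show "X + Y \<in> excess_filtration n"
    unfolding excess_filtration_iff lookup_add by (metis add_0)
qed (auto simp: excess_filtration_iff)

lemma hbasis_in_excess_filtration [simp]:
  "hbasis v \<in> excess_filtration n \<longleftrightarrow> excess_ge n v"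
  by (auto simp: excess_filtration_def)

lemma excess_filtration_mono:
  "X \<in> excess_filtration n \<Longrightarrow> m \<le> n \<Longrightarrow> X \<in> excess_filtration m"
  by (auto simp: excess_filtration_def intro: excess_ge_mono)

lemma hlin_in_excess_filtration:
  assumes "X \<in> excess_filtration m" "\<And>v. excess_ge m v \<Longrightarrow> f v \<in> excess_filtration n"
  shows "hlin f X \<in> excess_filtration n"
  unfolding hlin_def using assms
  by (intro hz.subspace_sum hz.subspace_scale subspace_excess_filtration)
     (auto simp: excess_filtration_def)

text \<open>Raising the first entry raises every partial sum by one; the empty list goes to
  \<open>0\<close>, which lies in every subspace.\<close>

lemma hI_in_excess_filtration:
  "X \<in> excess_filtration (n - 1) \<Longrightarrow> hI X \<in> excess_filtration n"
  unfolding hI_def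
  by (erule hlin_in_excess_filtration)
     (auto split: list.split simp: algebra_simps hz.subspace_0[OF subspace_excess_filtration])

lemma hJ_in_excess_filtration:
  "X \<in> excess_filtration (n + 1) \<Longrightarrow> hJ X \<in> excess_filtration n"
  unfolding hJ_def
  by (erule hlin_in_excess_filtration)
     (auto split: list.split simp: algebra_simps hz.subspace_0[OF subspace_excess_filtration])

text \<open>A leading zero lengthens the old prefixes without changing their sums, which costs one,
  and adds the prefix \<open>[0]\<close> of excess \<open>-1\<close>, whence
  \<open>n \<le> - 1\<close>.\<close>

lemma hcons_0_in_excess_filtration:
  "X \<in> excess_filtration (n + 1) \<Longrightarrow> n \<le> - 1 \<Longrightarrow> hcons 0 X \<in> excess_filtration n"
  unfolding hcons_def by (erule hlin_in_excess_filtration) simp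

text \<open>Here \<open>m\<close> and \<open>n\<close> are arbitrary lower bounds for
  \<open>E\<close>, so the induction hypothesis can be used with shifted bounds, also for an empty
  tail.\<close>

lemma shuffle_basis_in_excess_filtration:
  assumes "excess_ge m s" "excess_ge n t"
  shows "shuffle_basis s t \<in> excess_filtration (min (m + n) (min m n))"
  using assms
proof (induction s t arbitrary: m n rule: shuffle_basis.induct)
  case (1 t)
  then show ?case
    by (auto intro: excess_ge_mono)
next
  case (2 s1 s)
  then show ?case
    by (auto intro!: excess_ge_mono[of "m - (s1 - 1)"])
next
  case (3 s1 s t1 t)
  let ?F = "excess_filtration (min (m + n) (min m n))"
  note add = hz.subspace_add[OF subspace_excess_filtration]
  note diff = hz.subspace_diff[OF subspace_excess_filtration]
  from "3.prems" have m: "m \<le> s1 - 1" and n: "n \<le> t1 - 1"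
    by auto
  consider "s1 = 0" | "s1 > 0" "t1 = 0" | "s1 > 0" "t1 > 0" | "s1 > 0" "t1 < 0" | "s1 < 0"
    by linarith
  then show ?case
  proof cases
    case 1
    have A: "shuffle_basis s (t1 # t) \<in> excess_filtration (min (m + 1 + n) (min (m + 1) n))"
      using 1 "3.prems" by (intro "3.IH") (auto simp: add.commute)
    \<comment> \<open>\<open>hcons\<close> costs one, but \<open>n\<close> was not raised in
      \<open>A\<close>; since \<open>m \<le> - 1\<close>, the term \<open>m + n\<close> makes up for
      it: \<open>m + n + 1 \<le> n\<close>.\<close>
    have "hcons 0 (shuffle_basis s (t1 # t)) \<in> ?F"
      using 1 m by (intro hcons_0_in_excess_filtration excess_filtration_mono[OF A]) auto
    then show ?thesis
      using 1 by simp
  next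
    case 2
    have A: "shuffle_basis (s1 # s) t \<in> excess_filtration (min (m + (n + 1)) (min m (n + 1)))"
      using 2 "3.prems" by (intro "3.IH") (auto simp: add.commute)
    have "hcons 0 (shuffle_basis (s1 # s) t) \<in> ?F"
      using 2 n by (intro hcons_0_in_excess_filtration excess_filtration_mono[OF A]) auto
    then show ?thesis
      using 2 by simp
  next
    case 3
    have A: "shuffle_basis (s1 # s) ((t1 - 1) # t) \<in>
        excess_filtration (min (m + (n - 1)) (min m (n - 1)))"
      using 3 "3.prems" by (intro "3.IH") (auto simp: excess_ge_shift simp del: excess_ge.simps)
    have B: "shuffle_basis ((s1 - 1) # s) (t1 # t) \<in>
        excess_filtration (min (m - 1 + n) (min (m - 1) n))"
      using 3 "3.prems" by (intro "3.IH") (auto simp: excess_ge_shift simp del: excess_ge.simps)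
    \<comment> \<open>Lowering one of \<open>m\<close>, \<open>n\<close> by one lowers the minimum
      by at most one, which \<open>hI\<close> restores.\<close>
    have "hI (shuffle_basis (s1 # s) ((t1 - 1) # t)) +
        hI (shuffle_basis ((s1 - 1) # s) (t1 # t)) \<in> ?F"
      by (intro add hI_in_excess_filtration excess_filtration_mono[OF A]
          excess_filtration_mono[OF B]) auto
    then show ?thesis
      using 3 by simp
  next
    case 4
    have A: "shuffle_basis (s1 # s) ((t1 + 1) # t) \<in>
        excess_filtration (min (m + (n + 1)) (min m (n + 1)))"
      using 4 "3.prems" by (intro "3.IH") (auto simp: algebra_simps)
    have B: "shuffle_basis ((s1 - 1) # s) ((t1 + 1) # t) \<in>
        excess_filtration (min (m - 1 + (n + 1)) (min (m - 1) (n + 1)))"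
      using 4 "3.prems" by (intro "3.IH") (auto simp: algebra_simps)
    \<comment> \<open>Now \<open>n \<le> - 1\<close> gives \<open>m + n + 1 \<le> m\<close> for the
      \<open>hJ\<close> term and \<open>m + n \<le> m - 1\<close> for the subtracted one.\<close>
    have "hJ (shuffle_basis (s1 # s) ((t1 + 1) # t)) -
        shuffle_basis ((s1 - 1) # s) ((t1 + 1) # t) \<in> ?F"
      using 4 n by (intro diff hJ_in_excess_filtration excess_filtration_mono[OF A]
          excess_filtration_mono[OF B]) auto
    then show ?thesis
      using 4 by simp
  next
    case 5
    have A: "shuffle_basis ((s1 + 1) # s) (t1 # t) \<in>
        excess_filtration (min (m + 1 + n) (min (m + 1) n))"
      using 5 "3.prems" by (intro "3.IH") (auto simp: algebra_simps)
    have B: "shuffle_basis ((s1 + 1) # s) ((t1 - 1) # t) \<in>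
        excess_filtration (min (m + 1 + (n - 1)) (min (m + 1) (n - 1)))"
      using 5 "3.prems" by (intro "3.IH") (auto simp: algebra_simps)
    have "hJ (shuffle_basis ((s1 + 1) # s) (t1 # t)) -
        shuffle_basis ((s1 + 1) # s) ((t1 - 1) # t) \<in> ?F"
      using 5 m by (intro diff hJ_in_excess_filtration excess_filtration_mono[OF A]
          excess_filtration_mono[OF B]) auto
    then show ?thesis
      using 5 by simp
  qed
qed

text \<open>Turns the span into a condition on supports; conversely, \<open>X\<close> is the
  combination of the basis elements in its support.\<close>

lemma hz0_eq_excess_filtration: "hz0 = excess_filtration 1"
proof
  show "hz0 \<subseteq> excess_filtration 1"
    unfolding hz0_def
    by (rule hz.span_minimal[OF _ subspace_excess_filtration])
       (auto simp: admissible_iff_excess_ge)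
  show "excess_filtration 1 \<subseteq> hz0"
  proof
    fix X assume "X \<in> excess_filtration 1"
    then have "hlin hbasis X \<in> hz0"
      unfolding hlin_def hz0_def
      by (intro hz.span_sum hz.span_scale hz.span_base)
         (auto simp: excess_filtration_def admissible_iff_excess_ge)
    then show "X \<in> hz0"
      by (simp add: hlin_hbasis_id)
  qed
qed

theorem theorem4p5:
  shows "hz.subspace hz0 \<and> hone \<in> hz0 \<and> (\<forall>X\<in>hz0. \<forall>Y\<in>hz0. shuffle X Y \<in> hz0)"
proof (intro conjI ballI)
  fix X Y assume "X \<in> hz0" "Y \<in> hz0"
  moreover have "shuffle_basis s t \<in> excess_filtration 1" if "excess_ge 1 s" "excess_ge 1 t" for s t
    \<comment> \<open>For \<open>m = n = 1\<close> the bound is the minimum of 2, 1 and 1, hence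
      again 1.\<close>
    using shuffle_basis_in_excess_filtration[OF that] by (rule excess_filtration_mono) simp
  ultimately show "shuffle X Y \<in> hz0"
    unfolding shuffle_def hz0_eq_excess_filtration by (blast intro: hlin_in_excess_filtration)
qed (simp_all add: hz0_eq_excess_filtration subspace_excess_filtration)

end
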